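(* Let $n\ge 1$ be an integer and let $\boldsymbol{\xi}_k=(\xi_{1,k},\dots,\xi_{n,k})$, $k=1,2,3,\dots$, be an infinite sequence of points in $[0,1)^n$ which is well distributed. Then for almost all (with respect to Lebesgue measure) $\boldsymbol{\eta}=(\eta_1,\dots,\eta_n)\in[0,1)^n$ one has $$\liminf_{k\to\infty} k^{1/n}\max_{1\le j\le n}\|\xi_{j,k}-\eta_j\|=0.$$
   Context: For real $x$, $\|x\|=\min_{a\in\mathbb{Z}}|x-a|$ denotes the distance from $x$ to the nearest integer. For a real $C>0$, a positive integer $q$ and $\boldsymbol{\eta}=(\eta_1,\dots,\eta_n)\in[0,1)^n$, consider the box $$B_{C,q}(\boldsymbol{\eta})=\left[\eta_1,\eta_1+\frac{C}{q^{1/n}}\right)\times\cdots\times\left[\eta_n,\eta_n+\frac{C}{q^{1/n}}\right);$$ only those boxes that satisfy $B_{C,q}(\boldsymbol{\eta})\subset[0,1)^n$ are considered. Definition. An infinite sequence $\boldsymbol{\xi}_k=(\xi_{1,k},\dots,\xi_{n,k})$, $k=1,2,3,\dots$, of points in $[0,1)^n$ is called well distributed if there exist a constant $C>0$ and infinitely many positive integers $q$ such that for every box $B_{C,q}(\boldsymbol{\eta})\subset[0,1)^n$ (with $\boldsymbol{\eta}\in[0,1)^n$) there exists a positive integer $k\le q$ with $\boldsymbol{\xi}_k\in B_{C,q}(\boldsymbol{\eta})$. *)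

theory Defs
  imports "HOL-Analysis.Analysis"
begin

(* The infimum is attained; see dist_int_min below. *)
definition dist_int :: "real \<Rightarrow> real" where
  "dist_int x = (INF a::int. \<bar>x - of_int a\<bar>)"

lemma dist_int_min:
  "\<exists>a::int. dist_int x = \<bar>x - of_int a\<bar> \<and> (\<forall>b::int. dist_int x \<le> \<bar>x - of_int b\<bar>)"
proof -
  have "dist_int x = \<bar>x - of_int (round x)\<bar>"
    unfolding dist_int_def by (rule cInf_eq_minimum) (auto intro: round_diff_minimal)
  then show ?thesis
    by (metis round_diff_minimal)
qed

definition unit_cube_ho :: "(real ^ 'n) set" where
  "unit_cube_ho = {x. \<forall>j. 0 \<le> x $ j \<and> x $ j < 1}"

definition side_box :: "real \<Rightarrow> nat \<Rightarrow> real ^ 'n \<Rightarrow> (real ^ 'n) set" where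
  "side_box C q \<eta> =
     {x. \<forall>j. \<eta> $ j \<le> x $ j \<and> x $ j < \<eta> $ j + C / root CARD('n) (real q)}"

(* Sequences are indexed from 1; the value at index 0 is never used. *)
definition well_distributed :: "(nat \<Rightarrow> real ^ 'n) \<Rightarrow> bool" where
  "well_distributed \<xi> \<longleftrightarrow>
     (\<exists>C>0. infinite {q. q > 0 \<and>
        (\<forall>\<eta>\<in>unit_cube_ho. side_box C q \<eta> \<subseteq> unit_cube_ho \<longrightarrow>
           (\<exists>k\<in>{1..q}. \<xi> k \<in> side_box C q \<eta>))})"

end

theory Submission
  imports Defs
begin

text \<open>
  Suppose the liminf is positive at \<open>\<eta>\<close>. Then there are \<open>c > 0\<close> and \<open>K\<close> such that, for every
  \<open>k \<ge> K\<close>, the maximum of the coordinate distances modulo one between \<open>\<xi> k\<close> and \<open>\<eta>\<close> is at least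
  \<open>c / k\<^sup>1\<^sup>/\<^sup>n\<close>. Let \<open>E\<close> be the set of all such \<open>\<eta>\<close> in the cube, for fixed \<open>c\<close> and \<open>K\<close>, without
  the countably many points \<open>\<xi> k\<close>. For \<open>k \<ge> 1\<close> with \<open>K \<le> k \<le> q\<close>, the ball around \<open>\<xi> k\<close> of radius
  \<open>c / q\<^sup>1\<^sup>/\<^sup>n\<close> misses \<open>E\<close> (\<open>badly_approx_hole\<close>). Well-distribution places, for arbitrarily large
  \<open>q\<close>, some \<open>\<xi> k\<close> with \<open>k \<le> q\<close> within distance \<open>n C / q\<^sup>1\<^sup>/\<^sup>n\<close> of any given point of \<open>E\<close>. Hence
  \<open>E\<close> has, near each of its points and at arbitrarily small scales, holes whose radius is a fixed
  fraction of the scale. By Vitali's covering theorem a measurable set with this property is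
  negligible (\<open>negligible_if_porous\<close>). Countably many pairs \<open>(c, K)\<close> suffice, since \<open>c\<close> may be
  taken to be the reciprocal of a positive integer.
\<close>

section \<open>Porous sets are negligible\<close>

text \<open>
  A uniformly porous measurable set is negligible. In an open set \<open>U\<close> around \<open>S\<close> with
  \<open>U - S\<close> of measure below \<open>\<epsilon>\<close>, disjoint balls cover almost all of \<open>S\<close>, and the concentric
  balls shrunk by \<open>\<delta>\<close> lie in \<open>U - S\<close>; thus \<open>\<delta>\<close> to the power of the dimension times the
  measure of \<open>S\<close> is below \<open>\<epsilon>\<close>.
\<close>
lemma negligible_if_porous:
  fixes S :: "'a::euclidean_space set"
  assumes S: "S \<in> sets lebesgue" and \<delta>: "0 < \<delta>" "\<delta> \<le> 1"
    and porous: "\<And>x e. x \<in> S \<Longrightarrow> 0 < e \<Longrightarrow>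
      \<exists>y r. r < e \<and> dist x y < r \<and> ball y (\<delta> * r) \<inter> S = {}"
  shows "negligible S"
proof -
  let ?D = "ennreal (\<delta> ^ DIM('a))"
  \<comment> \<open>The factor is the ratio of the volumes of a hole and of the ball containing it.\<close>
  have bound: "?D * emeasure lebesgue S \<le> ennreal \<epsilon>" if "\<epsilon> > 0" for \<epsilon>
  proof -
    obtain U where U: "open U" "S \<subseteq> U" "emeasure lebesgue (U - S) < ennreal \<epsilon>"
      using sets_lebesgue_outer_open[OF S \<open>\<epsilon> > 0\<close>] by metis
    define K where "K = {(y, r). 0 < r \<and> ball y r \<subseteq> U \<and> ball y (\<delta> * r) \<inter> S = {}}"
    have cover: "\<exists>i. i \<in> K \<and> x \<in> ball (fst i) (snd i) \<and> snd i < d"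
      if "x \<in> S" "0 < d" for x d
    proof -
      obtain e where e: "e > 0" "ball x e \<subseteq> U"
        using U \<open>x \<in> S\<close> by (meson openE subsetD)
      obtain y r where yr: "r < min d (e / 2)" "dist x y < r" "ball y (\<delta> * r) \<inter> S = {}"
        using porous[OF \<open>x \<in> S\<close>, of "min d (e / 2)"] \<open>0 < d\<close> e by auto
      have "ball y r \<subseteq> ball x e"
      proof
        fix z assume "z \<in> ball y r"
        then show "z \<in> ball x e"
          using yr dist_triangle[of x z y] by simp
      qed
      moreover have "0 < r"
        using yr(2) zero_le_dist[of x y] by linarith
      ultimately have "(y, r) \<in> K"
        using yr e by (auto simp: K_def)
      then show ?thesis
        using yr by (intro exI[of _ "(y, r)"]) (auto simp: dist_commute)
    qed
    obtain C where C: "countable C" "C \<subseteq> K"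
      "pairwise (\<lambda>i j. disjnt (ball (fst i) (snd i)) (ball (fst j) (snd j))) C"
      "negligible (S - (\<Union>i \<in> C. ball (fst i) (snd i)))"
      using Vitali_covering_theorem_balls[of S K fst snd, OF cover] by blast
    define B where "B i = ball (fst i) (snd i)" for i :: "'a \<times> real"
    define H where "H i = ball (fst i) (\<delta> * snd i)" for i :: "'a \<times> real"
    have r_pos: "0 < snd i" if "i \<in> C" for i
      using C(2) that by (auto simp: K_def)
    have H_sub: "H i \<subseteq> B i" if "i \<in> C" for i
      using r_pos[OF that] \<delta> mult_left_le_one_le[of "snd i" \<delta>]
      unfolding H_def B_def by (intro subset_ball) simp
    have disj_B: "disjoint_family_on B C"
      using C(3) unfolding disjoint_family_on_def pairwise_def disjnt_def B_def by blast
    have disj_H: "disjoint_family_on H C"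
      using disj_B H_sub unfolding disjoint_family_on_def by blast
    have BH_sets: "B i \<in> sets lebesgue" "H i \<in> sets lebesgue" for i
      by (auto simp: B_def H_def)
    have H_eq: "emeasure lebesgue (H i) = ?D * emeasure lebesgue (B i)" if "i \<in> C" for i
    proof -
      have "emeasure lebesgue (ball y t) = ennreal (t ^ DIM('a) * measure lborel (ball (0::'a) 1))"
        if "t \<ge> 0" for y :: 'a and t
        using content_ball_conv_unit_ball[OF that, of y]
        by (subst emeasure_eq_measure2) auto
      then show ?thesis
        using r_pos[OF that] \<delta> by (simp add: H_def B_def power_mult_distrib ennreal_mult mult.assoc)
    qed
    have UB: "(\<Union>i\<in>C. B i) \<in> sets lebesgue" "(\<Union>i\<in>C. H i) \<in> sets lebesgue"
      using BH_sets C(1) by (auto intro!: sets.countable_UN')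
    have "S \<subseteq> (\<Union>i\<in>C. B i) \<union> (S - (\<Union>i\<in>C. B i))"
      by blast
    then have "emeasure lebesgue S \<le> emeasure lebesgue ((\<Union>i\<in>C. B i) \<union> (S - (\<Union>i\<in>C. B i)))"
      using UB S by (intro emeasure_mono) auto
    also have "\<dots> = emeasure lebesgue (\<Union>i\<in>C. B i)"
      using UB C(4) unfolding B_def
      by (intro emeasure_Un_null_set) (auto simp: negligible_iff_null_sets)
    also have "\<dots> = (\<integral>\<^sup>+i. emeasure lebesgue (B i) \<partial>count_space C)"
      using BH_sets C(1) disj_B by (intro emeasure_UN_countable) auto
    finally have "?D * emeasure lebesgue S \<le> ?D * (\<integral>\<^sup>+i. emeasure lebesgue (B i) \<partial>count_space C)"
      by (intro mult_left_mono) auto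
    also have "\<dots> = (\<integral>\<^sup>+i. ?D * emeasure lebesgue (B i) \<partial>count_space C)"
      by (simp add: nn_integral_cmult)
    also have "\<dots> = (\<integral>\<^sup>+i. emeasure lebesgue (H i) \<partial>count_space C)"
      by (intro nn_integral_cong) (simp add: H_eq)
    also have "\<dots> = emeasure lebesgue (\<Union>i\<in>C. H i)"
      using BH_sets C(1) disj_H by (intro emeasure_UN_countable[symmetric]) auto
    also have "\<dots> \<le> emeasure lebesgue (U - S)"
    proof (rule emeasure_mono)
      show "(\<Union>i\<in>C. H i) \<subseteq> U - S"
      proof -
        have "H i \<subseteq> U - S" if "i \<in> C" for i
          using H_sub[OF that] C(2) that unfolding H_def B_def K_def by fastforce
        then show ?thesis by blast
      qed
      show "U - S \<in> sets lebesgue"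
        using S U(1) by (intro sets.Diff) auto
    qed
    also have "\<dots> \<le> ennreal \<epsilon>"
      using U by simp
    finally show ?thesis .
  qed
  have "?D * emeasure lebesgue S \<le> 0"
    by (rule ennreal_le_epsilon) (use bound in simp)
  then have "emeasure lebesgue S = 0"
    using \<delta> by simp
  then show ?thesis
    using S by (simp add: negligible_iff_null_sets null_sets_def)
qed

section \<open>Distance to the nearest integer\<close>

lemma dist_int_nonneg: "0 \<le> dist_int x"
  by (metis abs_ge_zero dist_int_min)

lemma dist_int_le_abs: "dist_int x \<le> \<bar>x\<bar>"
  using dist_int_min[of x] by (metis diff_zero of_int_0)

lemma borel_measurable_dist_int [measurable]: "dist_int \<in> borel_measurable borel"
proof -
  have "dist_int = (\<lambda>x. \<bar>x - of_int \<lfloor>x + 1 / 2\<rfloor>\<bar>)"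
    unfolding dist_int_def round_def[symmetric]
    by (intro ext cInf_eq_minimum) (auto intro: round_diff_minimal)
  then show ?thesis
    by (rule ssubst) measurable
qed

lemma borel_measurable_vec_nth [measurable]: "(\<lambda>x::real^'n. x $ j) \<in> borel_measurable borel"
  by (intro borel_measurable_continuous_onI continuous_intros)

section \<open>Badly approximated points\<close>

text \<open>
  The points of the cube that \<open>\<xi>\<close> approximates badly, with constant \<open>c\<close>, from the index \<open>K\<close> on.
  The points of the sequence are removed so that each remaining point has a positive distance
  from the finitely many \<open>\<xi> k\<close> with \<open>k < K\<close>, around which no hole is available.
\<close>
definition badly_approx :: "(nat \<Rightarrow> real ^ 'n) \<Rightarrow> real \<Rightarrow> nat \<Rightarrow> (real ^ 'n) set" where
  "badly_approx \<xi> c K = {\<eta> \<in> unit_cube_ho. \<forall>k\<ge>K.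
     c \<le> root CARD('n) (real k) * (MAX j. dist_int (\<xi> k $ j - \<eta> $ j))} - range \<xi>"

lemma badly_approx_sets: "badly_approx (\<xi> :: nat \<Rightarrow> real ^ 'n) c K \<in> sets lebesgue"
proof -
  have [measurable]: "(\<lambda>\<eta>. MAX j. dist_int (\<xi> k $ j - \<eta> $ j)) \<in> borel_measurable borel" for k
    by (intro borel_measurable_Max) measurable
  have "{\<eta> \<in> space borel. (\<forall>j. 0 \<le> \<eta> $ j \<and> \<eta> $ j < 1) \<and> (\<forall>k\<ge>K.
      c \<le> root CARD('n) (real k) * (MAX j. dist_int (\<xi> k $ j - \<eta> $ j)))} \<in> sets borel"
    by measurable
  moreover have "range \<xi> \<in> sets borel"
    by (rule sets.countable) auto
  ultimately have "badly_approx \<xi> c K \<in> sets borel"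
    unfolding badly_approx_def unit_cube_ho_def by simp
  then show ?thesis
    by auto
qed

lemma badly_approx_hole:
  fixes \<xi> :: "nat \<Rightarrow> real ^ 'n"
  assumes "K \<le> k" "k \<le> q" "0 < k"
  shows "ball (\<xi> k) (c / root CARD('n) (real q)) \<inter> badly_approx \<xi> c K = {}"
proof -
  let ?R = "\<lambda>k. root CARD('n) (real k)"
  have "z \<notin> badly_approx \<xi> c K" if "z \<in> ball (\<xi> k) (c / ?R q)" for z
  proof
    assume z: "z \<in> badly_approx \<xi> c K"
    have R: "0 < ?R k" "?R k \<le> ?R q"
      using assms by auto
    have "dist_int (\<xi> k $ j - z $ j) < c / ?R q" for j
    proof -
      have "dist_int (\<xi> k $ j - z $ j) \<le> \<bar>(\<xi> k - z) $ j\<bar>"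
        using dist_int_le_abs[of "\<xi> k $ j - z $ j"] by simp
      also have "\<dots> \<le> dist (\<xi> k) z"
        unfolding dist_norm by (rule component_le_norm_cart)
      finally show ?thesis
        using that by simp
    qed
    then have M: "(MAX j. dist_int (\<xi> k $ j - z $ j)) < c / ?R q"
      by simp
    have "0 < c / ?R q"
      using that zero_le_dist[of "\<xi> k" z] by (auto simp del: zero_le_dist)
    have "?R k * (MAX j. dist_int (\<xi> k $ j - z $ j)) < ?R k * (c / ?R q)"
      using M R by (intro mult_strict_left_mono)
    also have "\<dots> \<le> ?R q * (c / ?R q)"
      using R \<open>0 < c / ?R q\<close> by (intro mult_right_mono) auto
    also have "\<dots> = c"
      using R by simp
    finally show False
      using z assms(1) by (force simp: badly_approx_def)
  qed
  then show ?thesis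
    by blast
qed

text \<open>
  The box with lower corner at a given point of the set contains a term of the sequence; once the
  box is small enough the index of that term is at least \<open>K\<close>.
\<close>
lemma negligible_badly_approx:
  fixes \<xi> :: "nat \<Rightarrow> real ^ 'n"
  assumes "well_distributed \<xi>" "0 < c"
  shows "negligible (badly_approx \<xi> c K)"
proof -
  let ?R = "\<lambda>k. root CARD('n) (real k)" and ?n = "real CARD('n)"
  obtain C where C: "C > 0" and inf: "infinite {q. q > 0 \<and>
      (\<forall>\<eta>\<in>unit_cube_ho. side_box C q \<eta> \<subseteq> unit_cube_ho \<longrightarrow>
         (\<exists>k\<in>{1..q}. \<xi> k \<in> side_box C q \<eta>))}"
    using assms(1) unfolding well_distributed_def by blast
  \<comment> \<open>\<open>L / root q\<close> bounds the distance to a nearby point of the sequence and exceeds the hole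
    radius \<open>c / root q\<close>, so \<open>c / L\<close> is the porosity constant.\<close>
  define L where "L = ?n * C + c"
  have L: "c < L" "0 < L"
    using C \<open>0 < c\<close> by (auto simp: L_def intro!: add_nonneg_pos)
  show ?thesis
  proof (rule negligible_if_porous[where \<delta> = "c / L"])
    fix x e assume x: "x \<in> badly_approx \<xi> c K" and "0 < (e::real)"
    then have x_cube: "x \<in> unit_cube_ho" and x_range: "x \<notin> range \<xi>"
      by (auto simp: badly_approx_def)
    obtain d where d: "d > 0" "\<And>k. k < K \<Longrightarrow> d \<le> dist x (\<xi> k)"
      using finite_set_avoid[of "\<xi> ` {..<K}" x] x_range
    by (metis finite_imageI finite_lessThan imageI lessThan_iff rangeI)
    define g where "g = Min (range (\<lambda>j. 1 - x $ j))"
    have g: "g > 0" "\<And>j. g \<le> 1 - x $ j"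
      using x_cube unfolding g_def unit_cube_ho_def by auto
    \<comment> \<open>A root above \<open>m\<close> makes the scale \<open>L / root q\<close> smaller than \<open>d\<close> and \<open>e\<close>, and keeps the box with
      lower corner \<open>x\<close> inside the cube.\<close>
    define m where "m = max (L / min d e) (C / g)"
    have "m > 0"
      using L d \<open>0 < e\<close> by (simp add: m_def less_max_iff_disj)
    obtain q where q: "m ^ CARD('n) < real q"
      and wd: "\<And>\<eta>. \<eta> \<in> unit_cube_ho \<Longrightarrow> side_box C q \<eta> \<subseteq> unit_cube_ho \<Longrightarrow>
        \<exists>k\<in>{1..q}. \<xi> k \<in> side_box C q \<eta>"
    proof -
      obtain q where "q > nat \<lceil>m ^ CARD('n)\<rceil>" "q \<in> {q. q > 0 \<and>
          (\<forall>\<eta>\<in>unit_cube_ho. side_box C q \<eta> \<subseteq> unit_cube_ho \<longrightarrow>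
            (\<exists>k\<in>{1..q}. \<xi> k \<in> side_box C q \<eta>))}"
        using inf unfolding infinite_nat_iff_unbounded by blast
      then show thesis
        by (intro that[of q]) (auto, linarith)
    qed
    have "m = root CARD('n) (m ^ CARD('n))"
      using \<open>m > 0\<close> by (simp add: real_root_power_cancel)
    also have "\<dots> < ?R q"
      using q by simp
    finally have mq: "m < ?R q" .
    then have "L / min d e < ?R q" "C / g < ?R q"
      by (auto simp: m_def)
    moreover have "0 < ?R q" "0 < min d e"
      using less_trans[OF \<open>m > 0\<close> mq] d(1) \<open>0 < e\<close> by simp_all
    ultimately have small: "L / ?R q < min d e" "C / ?R q < g"
      using g(1) by (metis mult.commute pos_divide_less_eq)+
    have "side_box C q x \<subseteq> unit_cube_ho"
    proof
      fix z assume z: "z \<in> side_box C q x"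
      have "0 \<le> z $ j \<and> z $ j < 1" for j
      proof -
        have "0 \<le> x $ j" "x $ j \<le> z $ j" "z $ j < x $ j + C / ?R q"
          using z x_cube by (auto simp: side_box_def unit_cube_ho_def)
        then show ?thesis
          using g(2)[of j] small(2) by linarith
      qed
      then show "z \<in> unit_cube_ho"
        by (simp add: unit_cube_ho_def)
    qed
    then obtain k where k: "k \<in> {1..q}" "\<xi> k \<in> side_box C q x"
      using wd x_cube by blast
    have "dist x (\<xi> k) \<le> (\<Sum>j\<in>UNIV. \<bar>(\<xi> k - x) $ j\<bar>)"
      unfolding dist_norm norm_minus_commute[of x] by (rule norm_le_l1_cart)
    also have "\<dots> \<le> (\<Sum>j\<in>(UNIV::'n set). C / ?R q)"
    proof (rule sum_mono)
      fix j
      show "\<bar>(\<xi> k - x) $ j\<bar> \<le> C / ?R q"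
        using k(2) by (auto simp: side_box_def abs_le_iff dest!: spec[of _ j])
    qed
    also have "\<dots> < L / ?R q"
      using less_trans[OF \<open>m > 0\<close> mq] \<open>0 < c\<close> by (simp add: L_def divide_strict_right_mono)
    finally have near: "dist x (\<xi> k) < L / ?R q" .
    then have "K \<le> k"
      using d(2)[of k] small(1) by (cases "k < K") auto
    then have "ball (\<xi> k) (c / ?R q) \<inter> badly_approx \<xi> c K = {}"
      using k(1) by (intro badly_approx_hole) auto
    then show "\<exists>y r. r < e \<and> dist x y < r \<and> ball y (c / L * r) \<inter> badly_approx \<xi> c K = {}"
      using near small(1) L by (intro exI[of _ "\<xi> k"] exI[of _ "L / ?R q"]) auto
  qed (use L \<open>0 < c\<close> badly_approx_sets in auto)
qed

section \<open>The liminf almost everywhere\<close>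

lemma liminf_eq_0_outside_badly_approx:
  fixes \<xi> :: "nat \<Rightarrow> real ^ 'n"
  assumes "\<eta> \<in> unit_cube_ho" "\<eta> \<notin> range \<xi>"
    and notin: "\<And>m K. \<eta> \<notin> badly_approx \<xi> (inverse (real (Suc m))) K"
  shows "liminf (\<lambda>k. ereal (root CARD('n) (real k) * (MAX j. dist_int (\<xi> k $ j - \<eta> $ j)))) = 0"
    (is "liminf (\<lambda>k. ereal (?f k)) = 0")
proof (rule antisym)
  have "0 \<le> (MAX j. dist_int (\<xi> k $ j - \<eta> $ j))" for k
    by (subst Max_ge_iff) (auto simp: dist_int_nonneg)
  then show "0 \<le> liminf (\<lambda>k. ereal (?f k))"
    by (intro Liminf_bounded always_eventually allI) simp
  show "liminf (\<lambda>k. ereal (?f k)) \<le> 0"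
  proof (rule ccontr)
    assume "\<not> liminf (\<lambda>k. ereal (?f k)) \<le> 0"
    then have "0 < liminf (\<lambda>k. ereal (?f k))"
      by (simp only: not_le)
    then obtain b where b: "0 < ereal b" "ereal b < liminf (\<lambda>k. ereal (?f k))"
      using ereal_dense2 by blast
    obtain m where m: "inverse (real (Suc m)) < b"
      using b(1) reals_Archimedean by auto
    have "eventually (\<lambda>k. ereal b < ereal (?f k)) sequentially"
      using less_LiminfD[OF b(2)] .
    then obtain K where "\<And>k. k \<ge> K \<Longrightarrow> b < ?f k"
      unfolding eventually_sequentially less_ereal.simps(1) by blast
    then have "inverse (real (Suc m)) \<le> ?f k" if "k \<ge> K" for k
      using m that by (meson less_imp_le less_trans)
    then have "\<eta> \<in> badly_approx \<xi> (inverse (real (Suc m))) K"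
      using assms(1,2) unfolding badly_approx_def by blast
    then show False
      using notin by blast
  qed
qed

theorem theorem1:
  fixes \<xi> :: "nat \<Rightarrow> real ^ 'n"
  assumes "\<And>k. k \<ge> 1 \<Longrightarrow> \<xi> k \<in> unit_cube_ho"
    and "well_distributed \<xi>"
  shows "AE \<eta> in lebesgue. \<eta> \<in> unit_cube_ho \<longrightarrow>
    liminf (\<lambda>k. ereal (root CARD('n) (real k) * (MAX j. dist_int (\<xi> k $ j - \<eta> $ j)))) = 0"
proof -
  have "AE \<eta> in lebesgue. \<forall>m K. \<eta> \<notin> badly_approx \<xi> (inverse (real (Suc m))) K"
    using negligible_badly_approx[OF assms(2)]
    by (auto simp: AE_all_countable negligible_iff_null_sets intro!: AE_not_in)
  moreover have "AE \<eta> in lebesgue. \<eta> \<notin> range \<xi>"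
    by (intro AE_not_in) (auto intro!: null_sets_completionI countable_imp_null_set_lborel)
  ultimately show ?thesis
    by eventually_elim (use liminf_eq_0_outside_badly_approx in blast)
qed

end
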